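(* Let $(A\triangleright P)$ be a propositional container and $j$ a modality. Then there exists a morphism of propositional containers $(A\triangleright P)\to \mathrm{Pred}_j$ if and only if $\mathcal{O}_P \le j$. In other words, regarding $P\mapsto \mathcal{O}_P$ and $j \mapsto \mathrm{Pred}_j$ as functors between the preorder reflection $\mathsf{PCont}_\le$ of propositional containers and the poset of modalities, $\mathcal{O}$ is left adjoint to $\mathrm{Pred}$. Moreover $\mathrm{Pred}$ is a section of $\mathcal{O}$: for every modality $j$, $j = \mathcal{O}_{I_j}$ (the oracle modality of the predicate of $\mathrm{Pred}_j$).
   Context: We work in the Calculus of Inductive Constructions with an impredicative universe $\mathsf{Prop}$ of proof-irrelevant propositions, together with function extensionality, propositional extensionality, uniqueness of proofs of propositions, and definite description. A modality is a monotone, inflationary, idempotent map $\mathsf{Prop}\to\mathsf{Prop}$, ordered pointwise. A propositional container $(A\triangleright P)$ consists of a type $A$ and $P:A\to\mathsf{Prop}$; a morphism $(A\triangleright P)\to(B\triangleright Q)$ consists of $t : A\to B$ and $q : \prod_{a:A} Q(t\,a)\to P\,a$. $\mathsf{PCont}_\le$ is the preorder with $(A\triangleright P)\le(B\triangleright Q)$ iff there exists such a morphism. For a modality $j$, $\mathrm{DProp}_j := \sum_{s:\mathsf{Prop}} j\,s$, $I_j : \mathrm{DProp}_j\to\mathsf{Prop}$ is the first projection, and $\mathrm{Pred}_j := (\mathrm{DProp}_j\triangleright I_j)$. For $P : A\to\mathsf{Prop}$, the oracle modality $\mathcal{O}_P$ is defined at $s$ as the inductive proposition with constructors $\mathsf{prf}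 : s \to \mathcal{O}_P\,s$ and $\mathsf{ask} : \prod_{a:A} (P\,a \to \mathcal{O}_P\,s) \to \mathcal{O}_P\,s$. *)

theory Defs
  imports Main
begin

section \<open>The Calculus of Inductive Constructions\<close>

(* The calculus is embedded deeply: rendering Prop as the type bool would make it two-valued and leave
   only two modalities. *)

datatype srt = Prop | Type nat

(* Constants for the axioms added to the calculus; their types are given by axiom_type below. *)
datatype ax = FunExt nat nat | PropExt | ProofIrrel | DefDescr nat

(* De Bruijn terms. In "Ind A Cs" (the inductive family of arity A with constructor types Cs) each
   element of Cs lies under one binder, which stands for the family being defined.
   "Constr n I" is the n-th constructor of I, and "Elim I Q fs c" is the dependent eliminator of I
   with motive Q, one branch in fs for each constructor, applied to c. *)
datatype tm =
    Var nat
  | Srt srt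
  | Ax ax
  | Pi tm tm
  | Lam tm tm
  | App tm tm
  | Ind tm "tm list"
  | Constr nat tm
  | Elim tm tm "tm list" tm

abbreviation apps :: "tm \<Rightarrow> tm list \<Rightarrow> tm" where
  "apps t us \<equiv> foldl App t us"

fun lift :: "nat \<Rightarrow> tm \<Rightarrow> tm" where
  "lift k (Var n) = Var (if n < k then n else Suc n)"
| "lift k (Srt s) = Srt s"
| "lift k (Ax a) = Ax a"
| "lift k (Pi A B) = Pi (lift k A) (lift (Suc k) B)"
| "lift k (Lam A t) = Lam (lift k A) (lift (Suc k) t)"
| "lift k (App t u) = App (lift k t) (lift k u)"
| "lift k (Ind A Cs) = Ind (lift k A) (map (lift (Suc k)) Cs)"
| "lift k (Constr n I) = Constr n (lift k I)"
| "lift k (Elim I Q fs c) = Elim (lift k I) (lift k Q) (map (lift k) fs) (lift k c)"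

abbreviation shift :: "tm \<Rightarrow> tm" where "shift \<equiv> lift 0"

(* "subst u k t" replaces variable k of t by u and removes it from the context. *)
fun subst :: "tm \<Rightarrow> nat \<Rightarrow> tm \<Rightarrow> tm" where
  "subst u k (Var n) = (if n < k then Var n else if n = k then u else Var (n - 1))"
| "subst u k (Srt s) = Srt s"
| "subst u k (Ax a) = Ax a"
| "subst u k (Pi A B) = Pi (subst u k A) (subst (shift u) (Suc k) B)"
| "subst u k (Lam A t) = Lam (subst u k A) (subst (shift u) (Suc k) t)"
| "subst u k (App t v) = App (subst u k t) (subst u k v)"
| "subst u k (Ind A Cs) = Ind (subst u k A) (map (subst (shift u) (Suc k)) Cs)"
| "subst u k (Constr n I) = Constr n (subst u k I)"
| "subst u k (Elim I Q fs c) = Elim (subst u k I) (subst u k Q) (map (subst u k) fs) (subst u k c)"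

fun occurs :: "nat \<Rightarrow> tm \<Rightarrow> bool" where
  "occurs k (Var n) \<longleftrightarrow> n = k"
| "occurs k (Srt s) \<longleftrightarrow> False"
| "occurs k (Ax a) \<longleftrightarrow> False"
| "occurs k (Pi A B) \<longleftrightarrow> occurs k A \<or> occurs (Suc k) B"
| "occurs k (Lam A t) \<longleftrightarrow> occurs k A \<or> occurs (Suc k) t"
| "occurs k (App t u) \<longleftrightarrow> occurs k t \<or> occurs k u"
| "occurs k (Ind A Cs) \<longleftrightarrow> occurs k A \<or> (\<exists>C\<in>set Cs. occurs (Suc k) C)"
| "occurs k (Constr n I) \<longleftrightarrow> occurs k I"
| "occurs k (Elim I Q fs c) \<longleftrightarrow>
     occurs k I \<or> occurs k Q \<or> (\<exists>f\<in>set fs. occurs k f) \<or> occurs k c"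


subsection \<open>The inductive scheme\<close>

fun arity_sort :: "tm \<Rightarrow> srt option" where
  "arity_sort (Srt s) = Some s"
| "arity_sort (Pi T A) = arity_sort A"
| "arity_sort _ = None"

(* Variable k applied to arguments in which it does not occur. *)
fun family_app :: "nat \<Rightarrow> tm \<Rightarrow> bool" where
  "family_app k (Var n) \<longleftrightarrow> n = k"
| "family_app k (App t u) \<longleftrightarrow> family_app k t \<and> \<not> occurs k u"
| "family_app k _ \<longleftrightarrow> False"

fun strictly_positive :: "nat \<Rightarrow> tm \<Rightarrow> bool" where
  "strictly_positive k (Pi U T) \<longleftrightarrow> \<not> occurs k U \<and> strictly_positive (Suc k) T"
| "strictly_positive k T \<longleftrightarrow> family_app k T"

(* Admissible constructor types of the family X = Var k: an argument either does not mention X,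
   or is recursive, i.e. of the form (y : U) -> X n with later arguments not depending on it. *)
fun constr_form :: "nat \<Rightarrow> tm \<Rightarrow> bool" where
  "constr_form k (Pi T C) \<longleftrightarrow>
     (\<not> occurs k T \<or> strictly_positive k T \<and> \<not> occurs 0 C) \<and> constr_form (Suc k) C"
| "constr_form k C \<longleftrightarrow> family_app k C"

fun num_args :: "tm \<Rightarrow> nat" where
  "num_args (Pi T C) = Suc (num_args C)"
| "num_args _ = 0"

(* The type (x : A) -> I x -> s of motives, where A is the arity of I. *)
fun motive_type :: "tm \<Rightarrow> tm \<Rightarrow> srt \<Rightarrow> tm" where
  "motive_type (Pi T A) I s = Pi T (motive_type A (App (shift I) (Var 0)) s)"
| "motive_type _ I s = Pi I (Srt s)"

fun replace_head :: "tm \<Rightarrow> tm \<Rightarrow> tm" where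
  "replace_head Q (App t u) = App (replace_head Q t) u"
| "replace_head Q _ = Q"

(* Induction hypothesis for a recursive argument r of type (y : U) -> X n,
   namely (y : U) -> Q n (r y). *)
fun ind_hyp :: "tm \<Rightarrow> tm \<Rightarrow> tm \<Rightarrow> tm" where
  "ind_hyp Q r (Pi U T) = Pi U (ind_hyp (shift Q) (App (shift r) (Var 0)) T)"
| "ind_hyp Q r T = App (replace_head Q T) r"

(* Type of the branch for a constructor c of type C, over a context in which the family is still
   the variable k. Each recursive argument is followed by its induction hypothesis. *)
fun branch :: "nat \<Rightarrow> tm \<Rightarrow> tm \<Rightarrow> tm \<Rightarrow> tm" where
  "branch k Q c (Pi T C) =
     (let R = branch (Suc k) (shift Q) (App (shift c) (Var 0)) C
      in Pi T (if occurs k T then Pi (ind_hyp (shift Q) (Var 0) (shift T)) (shift R) else R))"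
| "branch k Q c C = App (replace_head Q C) c"

definition branch_type :: "tm \<Rightarrow> tm \<Rightarrow> nat \<Rightarrow> tm \<Rightarrow> tm" where
  "branch_type I Q n C = subst I 0 (branch 0 (shift Q) (Constr n (shift I)) C)"

(* The recursive call on a : (y : U) -> I n, namely \<lambda>y. Elim I Q fs (a y). *)
fun rec_call :: "tm \<Rightarrow> tm \<Rightarrow> tm list \<Rightarrow> tm \<Rightarrow> tm \<Rightarrow> tm" where
  "rec_call I Q fs a (Pi U T) =
     Lam U (rec_call (shift I) (shift Q) (map shift fs) (App (shift a) (Var 0)) T)"
| "rec_call I Q fs a _ = Elim I Q fs a"

(* Applies the branch f to the constructor arguments, each recursive one followed by the recursive
   call on it; the last argument is the constructor type, whose variable 0 is the family. *)
fun iota :: "tm \<Rightarrow> tm \<Rightarrow> tm list \<Rightarrow> tm \<Rightarrow> tm list \<Rightarrow> tm \<Rightarrow> tm" where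
  "iota I Q fs f (a # as) (Pi T C) =
     iota I Q fs
       (if occurs 0 T then App (App f a) (rec_call I Q fs a (subst I 0 T)) else App f a)
       as (subst (shift a) 0 C)"
| "iota I Q fs f _ _ = f"


subsection \<open>Conversion and cumulativity\<close>

(* beta and iota only; eta is available propositionally, through FunExt. In iota the annotation I of
   the constructor is unconstrained: typing makes it convertible to the eliminated family. *)
inductive conv :: "tm \<Rightarrow> tm \<Rightarrow> bool" (infix "\<approx>" 50) where
  refl: "t \<approx> t"
| sym: "t \<approx> u \<Longrightarrow> u \<approx> t"
| trans: "t \<approx> u \<Longrightarrow> u \<approx> v \<Longrightarrow> t \<approx> v"
| beta: "App (Lam A t) u \<approx> subst u 0 t"
| iota: "\<lbrakk> n < length Cs; length fs = length Cs; constr_form 0 (Cs ! n);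
          length as = num_args (Cs ! n) \<rbrakk> \<Longrightarrow>
        Elim (Ind A Cs) Q fs (apps (Constr n I) as) \<approx> iota (Ind A Cs) Q fs (fs ! n) as (Cs ! n)"
| Pi: "A \<approx> A' \<Longrightarrow> B \<approx> B' \<Longrightarrow> Pi A B \<approx> Pi A' B'"
| Lam: "A \<approx> A' \<Longrightarrow> t \<approx> t' \<Longrightarrow> Lam A t \<approx> Lam A' t'"
| App: "t \<approx> t' \<Longrightarrow> u \<approx> u' \<Longrightarrow> App t u \<approx> App t' u'"
| Ind: "A \<approx> A' \<Longrightarrow> list_all2 (\<approx>) Cs Cs' \<Longrightarrow> Ind A Cs \<approx> Ind A' Cs'"
| Constr: "I \<approx> I' \<Longrightarrow> Constr n I \<approx> Constr n I'"
| Elim: "\<lbrakk> I \<approx> I'; Q \<approx> Q'; list_all2 (\<approx>) fs fs'; c \<approx> c' \<rbrakk> \<Longrightarrow> Elim I Q fs c \<approx> Elim I' Q' fs' c'"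

inductive cumul :: "tm \<Rightarrow> tm \<Rightarrow> bool" (infix "\<preceq>" 50) where
  conv: "A \<approx> B \<Longrightarrow> A \<preceq> B"
| trans: "A \<preceq> B \<Longrightarrow> B \<preceq> C \<Longrightarrow> A \<preceq> C"
| Prop: "Srt Prop \<preceq> Srt (Type n)"
| Type: "m \<le> n \<Longrightarrow> Srt (Type m) \<preceq> Srt (Type n)"
| Pi: "A \<approx> A' \<Longrightarrow> B \<preceq> B' \<Longrightarrow> Pi A B \<preceq> Pi A' B'"


subsection \<open>Named syntax\<close>

(* A term scheme assigns to a number n a de Bruijn term over a context of length n. A bound
   variable introduced at depth n is passed around as the scheme "\<lambda>m. Var (m - Suc n)", so that terms
   can be written with HOL variables, without explicit shifting. *)
type_synonym scheme = "nat \<Rightarrow> tm"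

definition bound :: "nat \<Rightarrow> scheme" where
  "bound n = (\<lambda>m. Var (m - Suc n))"

definition close :: "scheme \<Rightarrow> tm" where
  "close t = t 0"

definition sProp :: scheme where
  "sProp = (\<lambda>n. Srt Prop)"

definition sType :: "nat \<Rightarrow> scheme" where
  "sType i = (\<lambda>n. Srt (Type i))"

definition sPi :: "scheme \<Rightarrow> (scheme \<Rightarrow> scheme) \<Rightarrow> scheme" where
  "sPi A B = (\<lambda>n. Pi (A n) (B (bound n) (Suc n)))"

definition sLam :: "scheme \<Rightarrow> (scheme \<Rightarrow> scheme) \<Rightarrow> scheme" where
  "sLam A t = (\<lambda>n. Lam (A n) (t (bound n) (Suc n)))"

definition sApp :: "scheme \<Rightarrow> scheme \<Rightarrow> scheme" (infixl "\<cdot>" 90) where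
  "t \<cdot> u = (\<lambda>n. App (t n) (u n))"

definition sInd :: "scheme \<Rightarrow> (scheme \<Rightarrow> scheme) list \<Rightarrow> scheme" where
  "sInd A Cs = (\<lambda>n. Ind (A n) (map (\<lambda>C. C (bound n) (Suc n)) Cs))"

definition sElim :: "scheme \<Rightarrow> scheme \<Rightarrow> scheme list \<Rightarrow> scheme \<Rightarrow> scheme" where
  "sElim I Q fs c = (\<lambda>n. Elim (I n) (Q n) (map (\<lambda>f. f n) fs) (c n))"

syntax
  "_sPi" :: "pttrn \<Rightarrow> scheme \<Rightarrow> scheme \<Rightarrow> scheme"  ("(3\<Pi> _ \<in> _./ _)" [0, 26, 10] 10)
  "_sLam" :: "pttrn \<Rightarrow> scheme \<Rightarrow> scheme \<Rightarrow> scheme"  ("(3\<Lambda> _ \<in> _./ _)" [0, 26, 10] 10)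
translations
  "\<Pi> x \<in> A. B" \<rightleftharpoons> "CONST sPi A (\<lambda>x. B)"
  "\<Lambda> x \<in> A. t" \<rightleftharpoons> "CONST sLam A (\<lambda>x. t)"

abbreviation sFun :: "scheme \<Rightarrow> scheme \<Rightarrow> scheme" (infixr "\<rightarrow>" 27) where
  "A \<rightarrow> B \<equiv> sPi A (\<lambda>_. B)"


subsection \<open>Standard inductive types\<close>

definition Eq :: "scheme \<Rightarrow> scheme \<Rightarrow> scheme \<Rightarrow> scheme" where
  "Eq A a b = sInd (A \<rightarrow> sProp) [\<lambda>X. X \<cdot> a] \<cdot> b"

definition Conj :: "scheme \<Rightarrow> scheme \<Rightarrow> scheme" where
  "Conj p q = sInd sProp [\<lambda>X. p \<rightarrow> q \<rightarrow> X]"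

definition Iff :: "scheme \<Rightarrow> scheme \<Rightarrow> scheme" where
  "Iff p q = Conj (p \<rightarrow> q) (q \<rightarrow> p)"

definition Ex :: "scheme \<Rightarrow> (scheme \<Rightarrow> scheme) \<Rightarrow> scheme" where
  "Ex A P = sInd sProp [\<lambda>X. \<Pi> x \<in> A. P x \<rightarrow> X]"

definition Ex1 :: "scheme \<Rightarrow> (scheme \<Rightarrow> scheme) \<Rightarrow> scheme" where
  "Ex1 A P = Ex A (\<lambda>x. Conj (P x) (\<Pi> y \<in> A. P y \<rightarrow> Eq A y x))"

definition Inhabited :: "scheme \<Rightarrow> scheme" where
  "Inhabited A = sInd sProp [\<lambda>X. A \<rightarrow> X]"

(* The dependent sum, living in universe k. *)
definition Sigma_type :: "nat \<Rightarrow> scheme \<Rightarrow> (scheme \<Rightarrow> scheme) \<Rightarrow> scheme" where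
  "Sigma_type k A B = sInd (sType k) [\<lambda>X. \<Pi> x \<in> A. B x \<rightarrow> X]"

definition first :: "nat \<Rightarrow> scheme \<Rightarrow> (scheme \<Rightarrow> scheme) \<Rightarrow> scheme \<Rightarrow> scheme" where
  "first k A B c =
     sElim (Sigma_type k A B) (\<Lambda> _ \<in> Sigma_type k A B. A) [\<Lambda> x \<in> A. \<Lambda> _ \<in> B x. x] c"


subsection \<open>Typing\<close>

fun axiom_type :: "ax \<Rightarrow> tm" where
  "axiom_type (FunExt i j) = close
     (\<Pi> A \<in> sType i. \<Pi> B \<in> A \<rightarrow> sType j.
        \<Pi> f \<in> (\<Pi> x \<in> A. B \<cdot> x). \<Pi> g \<in> (\<Pi> x \<in> A. B \<cdot> x).
          (\<Pi> x \<in> A. Eq (B \<cdot> x) (f \<cdot> x) (g \<cdot> x)) \<rightarrow> Eq (\<Pi> x \<in> A. B \<cdot> x) f g)"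
| "axiom_type PropExt = close
     (\<Pi> p \<in> sProp. \<Pi> q \<in> sProp. Iff p q \<rightarrow> Eq sProp p q)"
| "axiom_type ProofIrrel = close
     (\<Pi> p \<in> sProp. \<Pi> x \<in> p. \<Pi> y \<in> p. Eq p x y)"
| "axiom_type (DefDescr i) = close
     (\<Pi> A \<in> sType i. \<Pi> P \<in> A \<rightarrow> sProp.
        Ex1 A (\<lambda>x. P \<cdot> x) \<rightarrow> Sigma_type i A (\<lambda>x. P \<cdot> x))"

(* Prop is impredicative. *)
fun pi_sort :: "srt \<Rightarrow> srt \<Rightarrow> srt" where
  "pi_sort s Prop = Prop"
| "pi_sort Prop (Type n) = Type n"
| "pi_sort (Type m) (Type n) = Type (max m n)"

(* Contexts list the innermost variable first. The judgement prop_args says that all arguments of a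
   constructor are proofs; it is the usual condition under which an inductive proposition with a
   single constructor may be eliminated into arbitrary types. *)
inductive wf_context :: "tm list \<Rightarrow> bool" ("\<turnstile> _" [50] 50)
  and typing :: "tm list \<Rightarrow> tm \<Rightarrow> tm \<Rightarrow> bool" ("_ \<turnstile> _ : _" [50, 50, 50] 50)
  and prop_args :: "tm list \<Rightarrow> tm \<Rightarrow> bool"
where
  wf_Nil: "\<turnstile> []"
| wf_Cons: "\<Gamma> \<turnstile> A : Srt s \<Longrightarrow> \<turnstile> A # \<Gamma>"
| Var: "\<turnstile> \<Gamma> \<Longrightarrow> n < length \<Gamma> \<Longrightarrow> \<Gamma> \<turnstile> Var n : (shift ^^ Suc n) (\<Gamma> ! n)"
| Prop: "\<turnstile> \<Gamma> \<Longrightarrow> \<Gamma> \<turnstile> Srt Prop : Srt (Type 0)"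
| Type: "\<turnstile> \<Gamma> \<Longrightarrow> \<Gamma> \<turnstile> Srt (Type n) : Srt (Type (Suc n))"
| Ax: "\<turnstile> \<Gamma> \<Longrightarrow> \<Gamma> \<turnstile> Ax a : axiom_type a"
| Pi: "\<Gamma> \<turnstile> A : Srt s \<Longrightarrow> A # \<Gamma> \<turnstile> B : Srt s' \<Longrightarrow> \<Gamma> \<turnstile> Pi A B : Srt (pi_sort s s')"
| Lam: "\<Gamma> \<turnstile> Pi A B : Srt s \<Longrightarrow> A # \<Gamma> \<turnstile> t : B \<Longrightarrow> \<Gamma> \<turnstile> Lam A t : Pi A B"
| App: "\<Gamma> \<turnstile> t : Pi A B \<Longrightarrow> \<Gamma> \<turnstile> u : A \<Longrightarrow> \<Gamma> \<turnstile> App t u : subst u 0 B"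
| Cumul: "\<Gamma> \<turnstile> t : A \<Longrightarrow> \<Gamma> \<turnstile> B : Srt s \<Longrightarrow> A \<preceq> B \<Longrightarrow> \<Gamma> \<turnstile> t : B"
| Ind: "\<lbrakk> \<Gamma> \<turnstile> A : Srt s\<^sub>0; arity_sort A = Some s;
         \<And>C. C \<in> set Cs \<Longrightarrow> constr_form 0 C; \<And>C. C \<in> set Cs \<Longrightarrow> A # \<Gamma> \<turnstile> C : Srt s \<rbrakk> \<Longrightarrow>
       \<Gamma> \<turnstile> Ind A Cs : A"
| Constr: "\<lbrakk> \<Gamma> \<turnstile> Ind A Cs : A; n < length Cs \<rbrakk> \<Longrightarrow>
       \<Gamma> \<turnstile> Constr n (Ind A Cs) : subst (Ind A Cs) 0 (Cs ! n)"
| Elim: "\<lbrakk> \<Gamma> \<turnstile> Ind A Cs : A; \<Gamma> \<turnstile> c : apps (Ind A Cs) us;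
         \<Gamma> \<turnstile> Q : motive_type A (Ind A Cs) s;
         s = Prop \<or> arity_sort A \<noteq> Some Prop \<or> Cs = [] \<or>
           (\<exists>C. Cs = [C] \<and> prop_args (A # \<Gamma>) C);
         length fs = length Cs;
         \<And>n. n < length Cs \<Longrightarrow> \<Gamma> \<turnstile> fs ! n : branch_type (Ind A Cs) Q n (Cs ! n) \<rbrakk> \<Longrightarrow>
       \<Gamma> \<turnstile> Elim (Ind A Cs) Q fs c : App (apps Q us) c"
| prop_args_Pi: "\<Gamma> \<turnstile> T : Srt Prop \<Longrightarrow> prop_args (T # \<Gamma>) C \<Longrightarrow> prop_args \<Gamma> (Pi T C)"
| prop_args_end: "family_app k C \<Longrightarrow> prop_args \<Gamma> C"

definition provable :: "scheme \<Rightarrow> bool" where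
  "provable \<phi> \<longleftrightarrow> (\<exists>t. [] \<turnstile> t : close \<phi>)"


section \<open>Propositional containers and modalities\<close>

definition modal_le :: "scheme \<Rightarrow> scheme \<Rightarrow> scheme" where
  "modal_le j k = (\<Pi> s \<in> sProp. j \<cdot> s \<rightarrow> k \<cdot> s)"

definition modality :: "scheme \<Rightarrow> scheme" where
  "modality j =
     Conj (\<Pi> s \<in> sProp. \<Pi> t \<in> sProp. (s \<rightarrow> t) \<rightarrow> j \<cdot> s \<rightarrow> j \<cdot> t)
    (Conj (\<Pi> s \<in> sProp. s \<rightarrow> j \<cdot> s)
          (\<Pi> s \<in> sProp. Eq sProp (j \<cdot> (j \<cdot> s)) (j \<cdot> s)))"

(* A container is a pair (A, P) with A : Type i and P : A -> Prop. *)
type_synonym container = "scheme \<times> scheme"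

fun container_mor :: "nat \<Rightarrow> container \<Rightarrow> container \<Rightarrow> scheme" where
  "container_mor i (A, P) (B, Q) =
     Sigma_type i (A \<rightarrow> B) (\<lambda>t. \<Pi> a \<in> A. Q \<cdot> (t \<cdot> a) \<rightarrow> P \<cdot> a)"

definition container_le :: "nat \<Rightarrow> container \<Rightarrow> container \<Rightarrow> scheme" where
  "container_le i X Y = Inhabited (container_mor i X Y)"

(* DProp j lives in Type 0, hence by cumulativity in every Type i. *)
definition DProp :: "scheme \<Rightarrow> scheme" where
  "DProp j = Sigma_type 0 sProp (\<lambda>s. j \<cdot> s)"

definition DProp_fst :: "scheme \<Rightarrow> scheme" where
  "DProp_fst j = (\<Lambda> d \<in> DProp j. first 0 sProp (\<lambda>s. j \<cdot> s) d)"

definition Pred :: "scheme \<Rightarrow> container" where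
  "Pred j = (DProp j, DProp_fst j)"

fun oracle_mod :: "container \<Rightarrow> scheme" where
  "oracle_mod (A, P) =
     (\<Lambda> s \<in> sProp. sInd sProp [\<lambda>X. s \<rightarrow> X, \<lambda>X. \<Pi> a \<in> A. (P \<cdot> a \<rightarrow> X) \<rightarrow> X])"

end

theory Submission
  imports Defs
begin

text \<open>
  Each of the five statements is proved by an explicit proof term of the calculus, whose typing is
  established by evaluating a type checker. The checker never relies on weakening, substitution or
  validity of the calculus: before using a conversion it infers the sort of the target type anew, so
  that each of its steps is literally a typing rule.

  The terms rest on one observation: if \<open>w : j p\<close> and \<open>f : p \<rightarrow> j s\<close>, then monotonicity and
  \<open>j (j s) = j s\<close> give \<open>j s\<close>. Given a morphism \<open>(t, q)\<close> into \<open>Pred j\<close>, induction on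
  \<open>O s\<close> therefore gives \<open>j s\<close>: a question \<open>a\<close> is answered by the \<open>j\<close>-dense proposition
  \<open>t a\<close>, which implies \<open>P a\<close>. Conversely \<open>P a\<close> is dense for \<open>O\<close>, by asking \<open>a\<close>.
\<close>

section \<open>A type checker\<close>

fun spine :: "tm \<Rightarrow> tm list \<Rightarrow> tm \<times> tm list" where
  "spine (App t u) us = spine t (u # us)"
| "spine t us = (t, us)"

fun nf_app :: "(tm \<Rightarrow> tm) \<Rightarrow> tm \<Rightarrow> tm \<Rightarrow> tm" where
  "nf_app N (Lam A t) u = N (subst u 0 t)"
| "nf_app N t u = App t u"

text \<open>The test repeats the side conditions of \<open>conv.iota\<close>, so every contraction
  is an instance of that rule; like the rule, it ignores the annotation \<open>J\<close> of the
  constructor.\<close>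

definition nf_elim :: "(tm \<Rightarrow> tm) \<Rightarrow> tm \<Rightarrow> tm \<Rightarrow> tm list \<Rightarrow> tm \<Rightarrow> tm" where
  "nf_elim N I Q fs c =
     (case spine c [] of (h, us) \<Rightarrow>
       (case h of
          Constr n J \<Rightarrow>
            (case I of
               Ind A Cs \<Rightarrow>
                 (if n < length Cs \<and> length fs = length Cs \<and> constr_form 0 (Cs ! n) \<and>
                     length us = num_args (Cs ! n)
                  then N (iota I Q fs (fs ! n) us (Cs ! n)) else Elim I Q fs c)
             | _ \<Rightarrow> Elim I Q fs c)
        | _ \<Rightarrow> Elim I Q fs c))"

fun nf_step :: "(tm \<Rightarrow> tm) \<Rightarrow> tm \<Rightarrow> tm" where
  "nf_step N (Var n) = Var n"
| "nf_step N (Srt s) = Srt s"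
| "nf_step N (Ax a) = Ax a"
| "nf_step N (Pi A B) = Pi (N A) (N B)"
| "nf_step N (Lam A t) = Lam (N A) (N t)"
| "nf_step N (App t u) = nf_app N (N t) (N u)"
| "nf_step N (Ind A Cs) = Ind (N A) (map N Cs)"
| "nf_step N (Constr n I) = Constr n (N I)"
| "nf_step N (Elim I Q fs c) = nf_elim N (N I) (N Q) (map N fs) (N c)"

text \<open>
  The number bounds the recursion depth. A term on which it is exhausted is left unnormalized, which
  is harmless, since only convertibility to the result matters.
\<close>
primrec nf :: "nat \<Rightarrow> tm \<Rightarrow> tm" where
  "nf 0 t = t"
| "nf (Suc n) t = nf_step (nf n) t"

section \<open>Cumulativity test on normal forms\<close>

fun srt_le :: "srt \<Rightarrow> srt \<Rightarrow> bool" where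
  "srt_le Prop s \<longleftrightarrow> True"
| "srt_le (Type m) Prop \<longleftrightarrow> False"
| "srt_le (Type m) (Type n) \<longleftrightarrow> m \<le> n"

text \<open>As in \<open>cumul.Pi\<close>, domains have to agree and only the final codomain may
  grow.\<close>

fun cumul_nf :: "tm \<Rightarrow> tm \<Rightarrow> bool" where
  "cumul_nf (Srt s) u = (case u of Srt s' \<Rightarrow> srt_le s s' | _ \<Rightarrow> False)"
| "cumul_nf (Pi A B) u = (case u of Pi A' B' \<Rightarrow> A = A' \<and> cumul_nf B B' | _ \<Rightarrow> False)"
| "cumul_nf t u = (t = u)"

definition is_subtype :: "(tm \<Rightarrow> tm) \<Rightarrow> tm \<Rightarrow> tm \<Rightarrow> bool" where
  "is_subtype N T T' = (if T = T' then True else cumul_nf (N T) (N T'))"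

section \<open>Type inference and checking\<close>

text \<open>
  In the following, \<open>N\<close> is a normalization function and \<open>R\<close> is type inference with a smaller bound on
  the recursion depth.
\<close>
type_synonym infer = "tm list \<Rightarrow> tm \<Rightarrow> tm option"

definition sort_of :: "(tm \<Rightarrow> tm) \<Rightarrow> infer \<Rightarrow> tm list \<Rightarrow> tm \<Rightarrow> srt option" where
  "sort_of N R \<Gamma> A =
     (case R \<Gamma> A of
        None \<Rightarrow> None
      | Some T \<Rightarrow> (case T of Srt s \<Rightarrow> Some s
          | _ \<Rightarrow> (case N T of Srt s \<Rightarrow> Some s | _ \<Rightarrow> None)))"

definition is_type :: "(tm \<Rightarrow> tm) \<Rightarrow> infer \<Rightarrow> tm list \<Rightarrow> tm \<Rightarrow> bool" where
  "is_type N R \<Gamma> A = (case sort_of N R \<Gamma> A of None \<Rightarrow> False | Some s \<Rightarrow> True)"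

text \<open>A product found only by normalization is inferred anew: \<open>Cumul\<close> wants a
  typed target, while normalization is known to preserve convertibility, not typing.\<close>

definition dest_Pi :: "(tm \<Rightarrow> tm) \<Rightarrow> infer \<Rightarrow> tm list \<Rightarrow> tm \<Rightarrow> (tm \<times> tm) option" where
  "dest_Pi N R \<Gamma> T =
     (case T of Pi A B \<Rightarrow> Some (A, B)
      | _ \<Rightarrow> (case N T of
           Pi A B \<Rightarrow> (if is_type N R \<Gamma> (Pi A B) then Some (A, B) else None)
         | _ \<Rightarrow> None))"

text \<open>Sound only if \<open>T\<close> is already known to be a type; \<open>check_arg\<close> does not presuppose this.\<close>
fun check :: "(tm \<Rightarrow> tm) \<Rightarrow> infer \<Rightarrow> tm list \<Rightarrow> tm \<Rightarrow> tm \<Rightarrow> bool" where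
  "check N R \<Gamma> (Lam A t) T =
     (case dest_Pi N R \<Gamma> T of
        None \<Rightarrow> False
      | Some AB \<Rightarrow> (case AB of (A', B) \<Rightarrow>
          (if A = A' then True
           else is_type N R \<Gamma> A \<and> N A = N A' \<and> is_type N R (A # \<Gamma>) B) \<and>
          check N R (A # \<Gamma>) t B))"
| "check N R \<Gamma> t T =
     (case R \<Gamma> t of None \<Rightarrow> False | Some T' \<Rightarrow> is_subtype N T' T)"

fun check_arg :: "(tm \<Rightarrow> tm) \<Rightarrow> infer \<Rightarrow> tm list \<Rightarrow> tm \<Rightarrow> tm \<Rightarrow> bool" where
  "check_arg N R \<Gamma> (Lam A t) T \<longleftrightarrow> is_type N R \<Gamma> T \<and> check N R \<Gamma> (Lam A t) T"
| "check_arg N R \<Gamma> t T =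
     (case R \<Gamma> t of None \<Rightarrow> False | Some T' \<Rightarrow>
       if T' = T then True else is_type N R \<Gamma> T \<and> is_subtype N T' T)"

fun check_branches ::
    "(tm \<Rightarrow> tm) \<Rightarrow> infer \<Rightarrow> tm list \<Rightarrow> tm \<Rightarrow> tm \<Rightarrow> nat \<Rightarrow> tm list \<Rightarrow> tm list \<Rightarrow> bool" where
  "check_branches N R \<Gamma> I Q n (f # fs) (C # Cs) \<longleftrightarrow>
     is_type N R \<Gamma> (branch_type I Q n C) \<and> check N R \<Gamma> f (branch_type I Q n C) \<and>
     check_branches N R \<Gamma> I Q (Suc n) fs Cs"
| "check_branches N R \<Gamma> I Q n [] [] \<longleftrightarrow> True"
| "check_branches N R \<Gamma> I Q n _ _ \<longleftrightarrow> False"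

text \<open>The result is a guess at the indices; \<open>infer_step\<close> verifies afterwards that
  \<open>T\<close> fits the family applied to them.\<close>

definition family_args :: "(tm \<Rightarrow> tm) \<Rightarrow> tm \<Rightarrow> tm \<Rightarrow> tm list" where
  "family_args N I T =
     (case spine T [] of (h, us) \<Rightarrow> if h = I then us else snd (spine (N T) []))"

text \<open>For \<open>Lam\<close>, the inferred type of the body must itself be a type, because the
  typing rule asks for a typed product. For \<open>Elim\<close>, the target sort is read off the
  inferred type of the motive, which is then compared with \<open>motive_type\<close>.\<close>

fun infer_step :: "(tm \<Rightarrow> tm) \<Rightarrow> infer \<Rightarrow> infer" where
  "infer_step N R \<Gamma> (Var n) =
     (if n < length \<Gamma> then Some ((shift ^^ Suc n) (\<Gamma> ! n)) else None)"
| "infer_step N R \<Gamma> (Srt s) =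
     (case s of Prop \<Rightarrow> Some (Srt (Type 0)) | Type n \<Rightarrow> Some (Srt (Type (Suc n))))"
| "infer_step N R \<Gamma> (Ax a) = Some (axiom_type a)"
| "infer_step N R \<Gamma> (Pi A B) =
     (case sort_of N R \<Gamma> A of None \<Rightarrow> None | Some s \<Rightarrow>
     (case sort_of N R (A # \<Gamma>) B of None \<Rightarrow> None | Some s' \<Rightarrow> Some (Srt (pi_sort s s'))))"
| "infer_step N R \<Gamma> (Lam A t) =
     (if is_type N R \<Gamma> A then
       (case R (A # \<Gamma>) t of None \<Rightarrow> None | Some B \<Rightarrow>
         (if is_type N R (A # \<Gamma>) B then Some (Pi A B) else None))
      else None)"
| "infer_step N R \<Gamma> (App t u) =
     (case R \<Gamma> t of None \<Rightarrow> None | Some T \<Rightarrow>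
     (case dest_Pi N R \<Gamma> T of None \<Rightarrow> None | Some AB \<Rightarrow>
     (case AB of (A, B) \<Rightarrow>
       if check_arg N R \<Gamma> u A then Some (subst u 0 B) else None)))"
| "infer_step N R \<Gamma> (Ind A Cs) =
     (case arity_sort A of None \<Rightarrow> None | Some s \<Rightarrow>
       if is_type N R \<Gamma> A \<and> list_all (constr_form 0) Cs \<and>
          list_all (\<lambda>C. case sort_of N R (A # \<Gamma>) C of None \<Rightarrow> False | Some s' \<Rightarrow> srt_le s' s) Cs
       then Some A else None)"
| "infer_step N R \<Gamma> (Constr n I) =
     (case I of
        Ind A Cs \<Rightarrow>
          (case R \<Gamma> (Ind A Cs) of None \<Rightarrow> None | Some A' \<Rightarrow>
            if A' = A \<and> n < length Cs then Some (subst (Ind A Cs) 0 (Cs ! n)) else None)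
      | _ \<Rightarrow> None)"
| "infer_step N R \<Gamma> (Elim I Q fs c) =
     (case I of
        Ind A Cs \<Rightarrow>
          (case R \<Gamma> (Ind A Cs) of None \<Rightarrow> None | Some A' \<Rightarrow>
          (case R \<Gamma> c of None \<Rightarrow> None | Some T \<Rightarrow>
          (case R \<Gamma> Q of None \<Rightarrow> None | Some TQ \<Rightarrow>
          (case arity_sort TQ of None \<Rightarrow> None | Some s \<Rightarrow>
            if A' = A \<and>
               (if T = apps (Ind A Cs) (family_args N (Ind A Cs) T) then True
                else is_type N R \<Gamma> (apps (Ind A Cs) (family_args N (Ind A Cs) T)) \<and>
                  is_subtype N T (apps (Ind A Cs) (family_args N (Ind A Cs) T))) \<and>
               TQ = motive_type A (Ind A Cs) s \<and>
               (case s of Prop \<Rightarrow> True | Type _ \<Rightarrow> arity_sort A \<noteq> Some Prop) \<and>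
               check_branches N R \<Gamma> (Ind A Cs) Q 0 fs Cs
            then Some (App (apps Q (family_args N (Ind A Cs) T)) c) else None))))
      | _ \<Rightarrow> None)"

primrec infer :: "nat \<Rightarrow> infer" where
  "infer 0 \<Gamma> t = None"
| "infer (Suc n) \<Gamma> t = infer_step (nf n) (infer n) \<Gamma> t"

definition check_closed :: "nat \<Rightarrow> tm \<Rightarrow> tm \<Rightarrow> bool" where
  "check_closed n t T \<longleftrightarrow> is_type (nf n) (infer n) [] T \<and> check (nf n) (infer n) [] t T"

section \<open>Soundness\<close>

lemma spine_apps: "spine t us = (h, vs) \<Longrightarrow> apps t us = apps h vs"
  by (induction t us rule: spine.induct) auto

lemma list_all2_map_conv: "(\<And>t. t \<approx> N t) \<Longrightarrow> list_all2 (\<approx>) ts (map N ts)"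
  by (simp add: list_all2_conv_all_nth)

lemma nf_app_conv:
  assumes "\<And>t. t \<approx> N t"
  shows "App t u \<approx> nf_app N t u"
  by (cases t) (auto intro: conv.refl conv.trans[OF conv.beta assms])

lemma nf_elim_conv:
  assumes "\<And>t. t \<approx> N t"
  shows "Elim I Q fs c \<approx> nf_elim N I Q fs c"
proof -
  obtain h us where c: "spine c [] = (h, us)" by fastforce
  have c': "c = apps h us" using spine_apps[OF c] by simp
  have "Elim (Ind A Cs) Q fs c \<approx> N (iota (Ind A Cs) Q fs (fs ! n) us (Cs ! n))"
    if "h = Constr n J" "n < length Cs" "length fs = length Cs" "constr_form 0 (Cs ! n)"
      "length us = num_args (Cs ! n)" for n J A Cs
    using conv.trans[OF conv.iota assms] that c' by auto
  then show ?thesis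
    by (auto simp: nf_elim_def c intro: conv.refl split: tm.split)
qed

lemma nf_step_conv:
  assumes N: "\<And>t. t \<approx> N t"
  shows "t \<approx> nf_step N t"
proof (cases t)
  case (App u v)
  then show ?thesis
    using conv.trans[OF conv.App[OF N N] nf_app_conv[OF N]] by simp
next
  case (Elim I Q fs c)
  then show ?thesis
    using conv.trans[OF conv.Elim[OF N N list_all2_map_conv[OF N] N] nf_elim_conv[OF N]] by simp
qed (auto intro: conv.intros N list_all2_map_conv)

lemma nf_conv: "t \<approx> nf n t"
  by (induction n arbitrary: t) (auto intro: conv.refl nf_step_conv)

lemma srt_le_cumul: "srt_le s s' \<Longrightarrow> Srt s \<preceq> Srt s'"
  by (induction s s' rule: srt_le.induct)
    (auto intro: cumul.intros conv.refl, metis conv.refl cumul.conv cumul.Prop srt.exhaust)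

lemma cumul_nf_cumul: "cumul_nf t u \<Longrightarrow> t \<preceq> u"
  by (induction t u rule: cumul_nf.induct)
    (auto intro: cumul.conv cumul.Pi conv.refl srt_le_cumul split: tm.splits)

lemma is_subtype_cumul:
  assumes N: "\<And>t. t \<approx> N t" and "is_subtype N T T'"
  shows "T \<preceq> T'"
proof (cases "T = T'")
  case True
  then show ?thesis by (simp add: cumul.conv conv.refl)
next
  case False
  then have "N T \<preceq> N T'" using assms(2) by (simp add: is_subtype_def cumul_nf_cumul)
  then show ?thesis
    by (meson N conv.sym cumul.conv cumul.trans)
qed

lemma srt_typed: "\<turnstile> \<Gamma> \<Longrightarrow> \<exists>s'. \<Gamma> \<turnstile> Srt s : Srt s'"
  by (cases s) (auto intro: wf_context_typing_prop_args.Prop wf_context_typing_prop_args.Type)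

text \<open>A product can be typed only by the rule \<open>Pi\<close>, possibly followed by uses of
  \<open>Cumul\<close>, which keep the term. The other two judgements of the mutual induction carry
  a trivial invariant.\<close>

lemma Pi_inversion:
  "\<Gamma> \<turnstile> T : U \<Longrightarrow> T = Pi A B \<Longrightarrow> (\<exists>s. \<Gamma> \<turnstile> A : Srt s) \<and> (\<exists>s. A # \<Gamma> \<turnstile> B : Srt s)"
  by (induction rule: wf_context_typing_prop_args.inducts(2)
        [where ?P1.0="\<lambda>_. True" and ?P3.0="\<lambda>_ _. True"]) auto

section \<open>Soundness of type inference\<close>

text \<open>One level of the recursion: \<open>N\<close> and \<open>R\<close> stand for
  normalization and inference at a given bound, of which only convertibility and soundness are
  assumed.\<close>

locale sound_checker =
  fixes N :: "tm \<Rightarrow> tm" and R :: infer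
  assumes N: "\<And>t. t \<approx> N t"
    and R: "\<And>\<Gamma> t T. \<turnstile> \<Gamma> \<Longrightarrow> R \<Gamma> t = Some T \<Longrightarrow> \<Gamma> \<turnstile> t : T"
begin

lemma sort_of_sound:
  assumes "\<turnstile> \<Gamma>" "sort_of N R \<Gamma> A = Some s"
  shows "\<Gamma> \<turnstile> A : Srt s"
proof -
  obtain T where T: "R \<Gamma> A = Some T" "T = Srt s \<or> N T = Srt s"
    using assms(2) by (auto simp: sort_of_def split: option.splits tm.splits)
  have "T \<approx> Srt s" using T(2) N[of T] by (auto intro: conv.refl)
  \<comment> \<open>\<open>Cumul\<close> applies because the target \<open>Srt s\<close> is itself
    typed in every well-formed context.\<close>
  then show ?thesis
    using R[OF assms(1) T(1)] srt_typed[OF assms(1)] by (meson cumul.conv wf_context_typing_prop_args.Cumul)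
qed

lemma is_type_sound:
  assumes "\<turnstile> \<Gamma>" "is_type N R \<Gamma> A"
  obtains s where "\<Gamma> \<turnstile> A : Srt s"
  using assms sort_of_sound by (auto simp: is_type_def split: option.splits)

lemma dest_Pi_conv: "dest_Pi N R \<Gamma> T = Some (A, B) \<Longrightarrow> T \<approx> Pi A B"
  using N[of T] by (auto simp: dest_Pi_def intro: conv.refl split: tm.splits if_splits)

lemma dest_Pi_typed:
  assumes "\<turnstile> \<Gamma>" "dest_Pi N R \<Gamma> T = Some (A, B)"
  shows "T = Pi A B \<or> (\<exists>s. \<Gamma> \<turnstile> Pi A B : Srt s)"
  using assms(2) is_type_sound[OF assms(1)]
  by (auto simp: dest_Pi_def split: tm.splits if_splits)

lemma check_infer_sound:
  assumes "\<turnstile> \<Gamma>" "\<Gamma> \<turnstile> T : Srt s" "R \<Gamma> t = Some T'" "is_subtype N T' T"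
  shows "\<Gamma> \<turnstile> t : T"
  using assms by (meson R N is_subtype_cumul wf_context_typing_prop_args.Cumul)

text \<open>An abstraction is first typed with its own annotation \<open>A\<close> and then moved to
  \<open>T\<close> by \<open>Cumul\<close>, which is why \<open>T\<close> must have a sort.\<close>

lemma check_sound:
  "\<turnstile> \<Gamma> \<Longrightarrow> \<Gamma> \<turnstile> T : Srt s \<Longrightarrow> check N R \<Gamma> t T \<Longrightarrow> \<Gamma> \<turnstile> t : T"
proof (induction t arbitrary: \<Gamma> T s)
  case (Lam A t)
  obtain A' B where AB: "dest_Pi N R \<Gamma> T = Some (A', B)"
    and A: "A = A' \<or> is_type N R \<Gamma> A \<and> N A = N A' \<and> is_type N R (A # \<Gamma>) B"
    and t: "check N R (A # \<Gamma>) t B"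
    using Lam.prems(3) by (auto split: option.splits if_splits)
  obtain s' where typed: "\<Gamma> \<turnstile> Pi A' B : Srt s'"
    using dest_Pi_typed[OF Lam.prems(1) AB] Lam.prems(2) by auto
  have A_conv: "A \<approx> A'" using A N by (metis conv.refl conv.sym conv.trans)
  \<comment> \<open>If \<open>A = A'\<close>, inversion of the product suffices. Otherwise the
    product only provides a sort for \<open>B\<close> over \<open>A'\<close>, and the sort over
    \<open>A\<close> comes from the separate test in \<open>check\<close>.\<close>
  obtain s1 s2 where s1: "\<Gamma> \<turnstile> A : Srt s1" and s2: "A # \<Gamma> \<turnstile> B : Srt s2"
  proof (cases "A = A'")
    case True
    then show ?thesis using Pi_inversion[OF typed HOL.refl] that by auto
  next
    case False
    then have A: "is_type N R \<Gamma> A" "is_type N R (A # \<Gamma>) B" using A by auto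
    obtain s1 where s1: "\<Gamma> \<turnstile> A : Srt s1" using A(1) Lam.prems(1) is_type_sound by blast
    moreover obtain s2 where "A # \<Gamma> \<turnstile> B : Srt s2"
      using A(2) is_type_sound wf_context_typing_prop_args.wf_Cons[OF s1] by blast
    ultimately show ?thesis using that by blast
  qed
  have "A # \<Gamma> \<turnstile> t : B"
    using Lam.IH(2)[OF _ s2 t] wf_context_typing_prop_args.wf_Cons[OF s1] by blast
  then have "\<Gamma> \<turnstile> Lam A t : Pi A B"
    using wf_context_typing_prop_args.Lam wf_context_typing_prop_args.Pi[OF s1 s2] by blast
  moreover have "Pi A B \<preceq> T"
    using dest_Pi_conv[OF AB] A_conv by (meson conv.Pi conv.refl conv.sym conv.trans cumul.conv)
  ultimately show ?case
    using Lam.prems(2) wf_context_typing_prop_args.Cumul by blast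
qed (auto split: option.splits intro: check_infer_sound)

lemma check_arg_sound:
  assumes wf: "\<turnstile> \<Gamma>" and "check_arg N R \<Gamma> t T"
  shows "\<Gamma> \<turnstile> t : T"
proof -
  have "R \<Gamma> t = Some T \<or> is_type N R \<Gamma> T \<and> check N R \<Gamma> t T"
    using assms(2) by (cases t) (auto split: option.splits if_splits)
  then show ?thesis
    using R[OF wf] check_sound[OF wf] is_type_sound[OF wf] by metis
qed

text \<open>The offset \<open>m\<close> counts the constructors already passed, so that
  \<open>branch_type\<close> keeps the right constructor index when the induction moves to the
  tails.\<close>

lemma check_branches_sound:
  assumes "\<turnstile> \<Gamma>"
  shows "check_branches N R \<Gamma> I Q m fs Cs \<Longrightarrow>
    length fs = length Cs \<and>
    (\<forall>n < length Cs. \<Gamma> \<turnstile> fs ! n : branch_type I Q (m + n) (Cs ! n))"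
proof (induction fs Cs arbitrary: m rule: list_induct2')
  case (4 f fs C Cs)
  then have "\<Gamma> \<turnstile> f : branch_type I Q m C"
    using assms is_type_sound check_sound by (metis check_branches.simps(1))
  then show ?case using 4 by (force simp: less_Suc_eq_0_disj)
qed auto

lemma infer_elim_sound:
  assumes wf: "\<turnstile> \<Gamma>" and e: "infer_step N R \<Gamma> (Elim I Q fs c) = Some U"
  shows "\<Gamma> \<turnstile> Elim I Q fs c : U"
proof -
  obtain A Cs T TQ s us where I: "I = Ind A Cs" and us: "us = family_args N I T"
    and *: "R \<Gamma> I = Some A" "R \<Gamma> c = Some T" "R \<Gamma> Q = Some TQ"
      "T = apps I us \<or> is_type N R \<Gamma> (apps I us) \<and> is_subtype N T (apps I us)"
      "TQ = motive_type A I s" "s = Prop \<or> arity_sort A \<noteq> Some Prop"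
      "check_branches N R \<Gamma> I Q 0 fs Cs" "U = App (apps Q us) c"
    using e by (auto split: tm.splits option.splits if_splits srt.splits)
  have "\<Gamma> \<turnstile> c : apps I us"
    using *(2,4) R[OF wf] is_type_sound[OF wf] check_infer_sound[OF wf] by metis
  moreover have "length fs = length Cs"
    "\<And>n. n < length Cs \<Longrightarrow> \<Gamma> \<turnstile> fs ! n : branch_type I Q n (Cs ! n)"
    using check_branches_sound[OF wf *(7)] by auto
  moreover have "\<Gamma> \<turnstile> I : A" "\<Gamma> \<turnstile> Q : motive_type A I s"
    using R[OF wf] * by auto
  ultimately show ?thesis
    unfolding I *(8) using *(6) by (auto intro!: wf_context_typing_prop_args.Elim)
qed

lemma infer_step_sound:
  assumes wf: "\<turnstile> \<Gamma>" and e: "infer_step N R \<Gamma> t = Some T"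
  shows "\<Gamma> \<turnstile> t : T"
proof (cases t)
  case (Var n)
  then show ?thesis using e wf_context_typing_prop_args.Var[OF wf] by (auto split: if_splits)
next
  case (Srt s)
  then show ?thesis
    using e wf by (auto split: srt.splits intro: wf_context_typing_prop_args.Prop wf_context_typing_prop_args.Type)
next
  case (Ax a)
  then show ?thesis using e wf by (auto intro: wf_context_typing_prop_args.Ax)
next
  case (Pi A B)
  obtain s s' where *: "sort_of N R \<Gamma> A = Some s" "sort_of N R (A # \<Gamma>) B = Some s'"
    "T = Srt (pi_sort s s')"
    using e Pi by (auto split: option.splits)
  have A: "\<Gamma> \<turnstile> A : Srt s" using sort_of_sound[OF wf *(1)] .
  have "A # \<Gamma> \<turnstile> B : Srt s'"
    using sort_of_sound[OF wf_context_typing_prop_args.wf_Cons[OF A] *(2)] .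
  then show ?thesis unfolding Pi *(3) using wf_context_typing_prop_args.Pi[OF A] by blast
next
  case (Lam A u)
  obtain B where B: "is_type N R \<Gamma> A" "R (A # \<Gamma>) u = Some B" "is_type N R (A # \<Gamma>) B" "T = Pi A B"
    using e Lam by (auto split: option.splits if_splits)
  obtain s where s: "\<Gamma> \<turnstile> A : Srt s" using B wf is_type_sound by blast
  have wf': "\<turnstile> A # \<Gamma>" using s by (rule wf_context_typing_prop_args.wf_Cons)
  then obtain s' where s': "A # \<Gamma> \<turnstile> B : Srt s'" using B is_type_sound by blast
  show ?thesis
    unfolding Lam B(4)
    using wf_context_typing_prop_args.Lam[OF wf_context_typing_prop_args.Pi[OF s s'] R[OF wf' B(2)]] .
next
  case (App u v)
  obtain U A B where *: "R \<Gamma> u = Some U" "dest_Pi N R \<Gamma> U = Some (A, B)"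
    "check_arg N R \<Gamma> v A" "T = subst v 0 B"
    using e App by (auto split: option.splits if_splits)
  \<comment> \<open>If \<open>U\<close> is not literally this product, the product has a sort and
    \<open>Cumul\<close> moves \<open>u\<close> to it.\<close>
  have "\<Gamma> \<turnstile> u : Pi A B"
    using R[OF wf *(1)] dest_Pi_typed[OF wf *(2)] dest_Pi_conv[OF *(2)]
      wf_context_typing_prop_args.Cumul cumul.conv by blast
  moreover have "\<Gamma> \<turnstile> v : A"
    using check_arg_sound[OF wf *(3)] .
  ultimately show ?thesis
    unfolding App *(4) by (rule wf_context_typing_prop_args.App)
next
  case (Ind A Cs)
  obtain s where *: "arity_sort A = Some s" "is_type N R \<Gamma> A" "\<And>C. C \<in> set Cs \<Longrightarrow> constr_form 0 C"
    "\<And>C. C \<in> set Cs \<Longrightarrow> \<exists>s'. sort_of N R (A # \<Gamma>) C = Some s' \<and> srt_le s' s" "T = A"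
    using e Ind by (fastforce simp: list_all_iff split: option.splits if_splits)
  obtain s0 where s0: "\<Gamma> \<turnstile> A : Srt s0" using * wf is_type_sound by blast
  have wf': "\<turnstile> A # \<Gamma>" using s0 by (rule wf_context_typing_prop_args.wf_Cons)
  \<comment> \<open>The rule \<open>Ind\<close> demands the sort of the arity; a smaller inferred
    sort is raised by cumulativity.\<close>
  have "A # \<Gamma> \<turnstile> C : Srt s" if "C \<in> set Cs" for C
    using *(4)[OF that] sort_of_sound[OF wf'] srt_typed[OF wf', of s] srt_le_cumul
      wf_context_typing_prop_args.Cumul by blast
  then show ?thesis
    unfolding Ind *(5) using s0 * wf_context_typing_prop_args.Ind by blast
next
  case (Constr n I)
  then show ?thesis
    using e R[OF wf] wf_context_typing_prop_args.Constr by (auto split: tm.splits option.splits if_splits)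
next
  case (Elim I Q fs c)
  then show ?thesis using infer_elim_sound[OF wf] e by blast
qed

end

text \<open>Each increase of the bound is one instance of the locale; at bound 0 inference never
  succeeds.\<close>

lemma infer_sound: "\<turnstile> \<Gamma> \<Longrightarrow> infer n \<Gamma> t = Some T \<Longrightarrow> \<Gamma> \<turnstile> t : T"
proof (induction n arbitrary: \<Gamma> t T)
  case (Suc n)
  interpret sound_checker "nf n" "infer n"
    by unfold_locales (auto intro: nf_conv Suc.IH)
  show ?case using infer_step_sound Suc.prems by simp
qed simp

text \<open>Reflection: \<open>close t\<close> is the witness demanded by \<open>provable\<close>,
  and evaluating the checker replaces its typing derivation.\<close>

lemma check_closed_provable:
  assumes "check_closed n (close t) (close \<phi>)"
  shows "provable \<phi>"
proof -
  interpret sound_checker "nf n" "infer n"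
    by unfold_locales (auto intro: nf_conv infer_sound)
  show ?thesis
    using assms is_type_sound check_sound wf_context_typing_prop_args.wf_Nil
    unfolding check_closed_def provable_def by metis
qed

section \<open>Proof terms\<close>

definition sConstr :: "nat \<Rightarrow> scheme \<Rightarrow> scheme" where
  "sConstr k I = (\<lambda>n. Constr k (I n))"

definition sAx :: "ax \<Rightarrow> scheme" where
  "sAx a = (\<lambda>_. Ax a)"

definition conj_pair where "conj_pair p q x y = sConstr 0 (Conj p q) \<cdot> x \<cdot> y"
definition conj_fst where
  "conj_fst p q c = sElim (Conj p q) (\<Lambda> _ \<in> Conj p q. p) [\<Lambda> x \<in> p. \<Lambda> _ \<in> q. x] c"
definition conj_snd where
  "conj_snd p q c = sElim (Conj p q) (\<Lambda> _ \<in> Conj p q. q) [\<Lambda> _ \<in> p. \<Lambda> y \<in> q. y] c"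
definition iff_pair where "iff_pair p q f g = conj_pair (p \<rightarrow> q) (q \<rightarrow> p) f g"

text \<open>Transport along an equality of propositions: induction on \<open>e\<close> with a motive
  sending \<open>b\<close> to itself, so that \<open>x\<close> is the reflexivity branch. The first
  argument is the family underlying \<open>Eq\<close>, not yet applied to its index.\<close>

definition cast where
  "cast p q e x = sElim (sInd (sProp \<rightarrow> sProp) [\<lambda>X. X \<cdot> p])
     (\<Lambda> b \<in> sProp. \<Lambda> _ \<in> Eq sProp p b. b) [x] e"

definition propext where
  "propext p q f g = sAx PropExt \<cdot> p \<cdot> q \<cdot> iff_pair p q f g"

text \<open>This and the next two are the conjuncts of \<open>modality\<close>, named because the
  projections are annotated with them.\<close>

definition monotone where
  "monotone j = (\<Pi> s \<in> sProp. \<Pi> t \<in> sProp. (s \<rightarrow> t) \<rightarrow> j \<cdot> s \<rightarrow> j \<cdot> t)"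
definition inflationary where
  "inflationary j = (\<Pi> s \<in> sProp. s \<rightarrow> j \<cdot> s)"
definition idempotent where
  "idempotent j = (\<Pi> s \<in> sProp. Eq sProp (j \<cdot> (j \<cdot> s)) (j \<cdot> s))"

definition modality_mono where
  "modality_mono j m =
     conj_fst (monotone j) (Conj (inflationary j) (idempotent j)) m"
definition modality_unit where
  "modality_unit j m = conj_fst (inflationary j) (idempotent j)
     (conj_snd (monotone j) (Conj (inflationary j) (idempotent j)) m)"
definition modality_idem where
  "modality_idem j m = conj_snd (inflationary j) (idempotent j)
     (conj_snd (monotone j) (Conj (inflationary j) (idempotent j)) m)"

text \<open>Kleisli extension: monotonicity at \<open>p\<close> and \<open>j \<cdot> s\<close> gives
  \<open>j \<cdot> (j \<cdot> s)\<close>; idempotence is an equality of propositions, hence the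
  cast.\<close>

definition modality_bind where
  "modality_bind j m p s w f =
     cast (j \<cdot> (j \<cdot> s)) (j \<cdot> s) (modality_idem j m \<cdot> s) (modality_mono j m \<cdot> p \<cdot> (j \<cdot> s) \<cdot> f \<cdot> w)"

section \<open>Combinators for oracle computations and container morphisms\<close>

text \<open>The beta reduct of \<open>oracle_mod (A, P) \<cdot> s\<close>: the checker accepts
  constructors and eliminators only when annotated with a literal \<open>Ind\<close>.\<close>

definition Oracle where
  "Oracle A P s = sInd sProp [\<lambda>X. s \<rightarrow> X, \<lambda>X. \<Pi> a \<in> A. (P \<cdot> a \<rightarrow> X) \<rightarrow> X]"
definition oracle_prf where "oracle_prf A P s x = sConstr 0 (Oracle A P s) \<cdot> x"
definition oracle_ask where "oracle_ask A P s a f = sConstr 1 (Oracle A P s) \<cdot> a \<cdot> f"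
text \<open>In the second branch the anonymous binder is the recursive argument and \<open>h\<close>
  its induction hypothesis; only the latter is passed to \<open>g\<close>.\<close>

definition oracle_rec where
  "oracle_rec A P s G f g x = sElim (Oracle A P s) (\<Lambda> _ \<in> Oracle A P s. G)
     [\<Lambda> y \<in> s. f y, \<Lambda> a \<in> A. \<Lambda> _ \<in> P \<cdot> a \<rightarrow> Oracle A P s. \<Lambda> h \<in> P \<cdot> a \<rightarrow> G. g a h] x"

definition DProp_pair where "DProp_pair j s w = sConstr 0 (DProp j) \<cdot> s \<cdot> w"

text \<open>The projection computes only on a pair, so \<open>d\<close> is split into
  \<open>s'\<close> and its witness \<open>w\<close>. The map from the projection to
  \<open>p\<close> depends on \<open>d\<close> and therefore belongs to the motive.\<close>

definition DProp_bind where
  "DProp_bind j m p s g d =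
    sElim (DProp j) (\<Lambda> d \<in> DProp j. (first 0 sProp (\<lambda>s. j \<cdot> s) d \<rightarrow> p) \<rightarrow> j \<cdot> s)
      [\<Lambda> s' \<in> sProp. \<Lambda> w \<in> j \<cdot> s'. \<Lambda> h \<in> s' \<rightarrow> p. modality_bind j m s' s w (\<Lambda> z \<in> s'. g \<cdot> (h \<cdot> z))] d"

text \<open>The outer elimination removes the truncation \<open>Inhabited\<close>, so
  \<open>G\<close> has to be a proposition; the inner one splits the dependent pair.\<close>

definition mor_elim where
  "mor_elim i A P B Q G f h =
    sElim (container_le i (A, P) (B, Q)) (\<Lambda> _ \<in> container_le i (A, P) (B, Q). G)
      [\<Lambda> c \<in> container_mor i (A, P) (B, Q).
         sElim (container_mor i (A, P) (B, Q)) (\<Lambda> _ \<in> container_mor i (A, P) (B, Q). G)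
           [\<Lambda> t \<in> A \<rightarrow> B. \<Lambda> q \<in> (\<Pi> a \<in> A. Q \<cdot> (t \<cdot> a) \<rightarrow> P \<cdot> a). f t q] c] h"

definition mor_intro where
  "mor_intro i A P B Q t q = sConstr 0 (container_le i (A, P) (B, Q)) \<cdot>
     (sConstr 0 (container_mor i (A, P) (B, Q)) \<cdot> t \<cdot> q)"

section \<open>The five proof terms\<close>

text \<open>In the converse direction \<open>a\<close> is sent to \<open>P \<cdot> a\<close> with
  its density witness. The projection of this pair reduces to \<open>P \<cdot> a\<close>, so the
  second component of the morphism is the identity.\<close>

definition adjunction_term where "adjunction_term i =
  (\<Lambda> A \<in> sType i. \<Lambda> P \<in> A \<rightarrow> sProp. \<Lambda> j \<in> sProp \<rightarrow> sProp. \<Lambda> m \<in> modality j.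
    iff_pair (container_le i (A, P) (Pred j)) (modal_le (oracle_mod (A, P)) j)
      (\<Lambda> h \<in> container_le i (A, P) (Pred j).
        mor_elim i A P (DProp j) (DProp_fst j) (modal_le (oracle_mod (A, P)) j) (\<lambda>t q.
          \<Lambda> s \<in> sProp. \<Lambda> x \<in> oracle_mod (A, P) \<cdot> s.
            oracle_rec A P s (j \<cdot> s) (\<lambda>y. modality_unit j m \<cdot> s \<cdot> y)
              (\<lambda>a g. DProp_bind j m (P \<cdot> a) s g (t \<cdot> a) \<cdot> (q \<cdot> a)) x) h)
      (\<Lambda> h \<in> modal_le (oracle_mod (A, P)) j.
        mor_intro i A P (DProp j) (DProp_fst j)
          (\<Lambda> a \<in> A. DProp_pair j (P \<cdot> a) (h \<cdot> (P \<cdot> a) \<cdot>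
             oracle_ask A P (P \<cdot> a) a (\<Lambda> y \<in> P \<cdot> a. oracle_prf A P (P \<cdot> a) y)))
          (\<Lambda> a \<in> A. \<Lambda> x \<in> P \<cdot> a. x)))"

definition oracle_mono where "oracle_mono A P =
  (\<Lambda> s \<in> sProp. \<Lambda> t \<in> sProp. \<Lambda> f \<in> s \<rightarrow> t. \<Lambda> x \<in> oracle_mod (A, P) \<cdot> s.
     oracle_rec A P s (Oracle A P t) (\<lambda>y. oracle_prf A P t (f \<cdot> y)) (\<lambda>a h. oracle_ask A P t a h) x)"
definition oracle_unit where "oracle_unit A P = (\<Lambda> s \<in> sProp. \<Lambda> x \<in> s. oracle_prf A P s x)"
text \<open>Flattening a nested computation: an outer result already is an inner computation, and an
  outer question is asked again.\<close>

definition oracle_idem where "oracle_idem A P =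
  (let X = oracle_mod (A, P) in \<Lambda> s \<in> sProp. propext (X \<cdot> (X \<cdot> s)) (X \<cdot> s)
    (\<Lambda> x \<in> X \<cdot> (X \<cdot> s). oracle_rec A P (X \<cdot> s) (X \<cdot> s) (\<lambda>y. y) (\<lambda>a h. oracle_ask A P s a h) x)
    (\<Lambda> x \<in> X \<cdot> s. oracle_prf A P (X \<cdot> s) x))"

definition oracle_modality_term where "oracle_modality_term i =
  (\<Lambda> A \<in> sType i. \<Lambda> P \<in> A \<rightarrow> sProp. let X = oracle_mod (A, P) in
    conj_pair (monotone X) (Conj (inflationary X) (idempotent X)) (oracle_mono A P)
     (conj_pair (inflationary X) (idempotent X) (oracle_unit A P) (oracle_idem A P)))"

text \<open>The question \<open>a\<close> is forwarded as \<open>t \<cdot> a\<close>;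
  \<open>q\<close> turns an answer to it into one for \<open>a\<close>, to which the induction
  hypothesis applies.\<close>

definition oracle_functor_term where "oracle_functor_term i =
  (\<Lambda> A \<in> sType i. \<Lambda> P \<in> A \<rightarrow> sProp. \<Lambda> B \<in> sType i. \<Lambda> Q \<in> B \<rightarrow> sProp.
    \<Lambda> h \<in> container_le i (A, P) (B, Q).
      mor_elim i A P B Q (modal_le (oracle_mod (A, P)) (oracle_mod (B, Q))) (\<lambda>t q.
        \<Lambda> s \<in> sProp. \<Lambda> x \<in> oracle_mod (A, P) \<cdot> s.
          oracle_rec A P s (Oracle B Q s) (\<lambda>y. oracle_prf B Q s y)
            (\<lambda>a g. oracle_ask B Q s (t \<cdot> a) (\<Lambda> y \<in> Q \<cdot> (t \<cdot> a). g \<cdot> (q \<cdot> a \<cdot> y))) x) h)"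

text \<open>The map \<open>t\<close> keeps the proposition and changes only the witness. Once
  \<open>d\<close> is split, both projections reduce to the same \<open>s\<close>, so the second
  component is the identity.\<close>

definition Pred_functor_term where "Pred_functor_term i =
  (\<Lambda> j \<in> sProp \<rightarrow> sProp. \<Lambda> k \<in> sProp \<rightarrow> sProp. \<Lambda> _ \<in> modality j. \<Lambda> _ \<in> modality k.
    \<Lambda> h \<in> modal_le j k.
      let t = (\<Lambda> d \<in> DProp j. sElim (DProp j) (\<Lambda> _ \<in> DProp j. DProp k)
                 [\<Lambda> s \<in> sProp. \<Lambda> w \<in> j \<cdot> s. DProp_pair k s (h \<cdot> s \<cdot> w)] d)
      in mor_intro i (DProp j) (DProp_fst j) (DProp k) (DProp_fst k) t
        (\<Lambda> d \<in> DProp j. sElim (DProp j) (\<Lambda> d \<in> DProp j. DProp_fst k \<cdot> (t \<cdot> d) \<rightarrow> DProp_fst j \<cdot> d)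
           [\<Lambda> s \<in> sProp. \<Lambda> w \<in> j \<cdot> s. \<Lambda> x \<in> s. x] d))"

text \<open>Function and propositional extensionality reduce the equality to two implications. A
  witness \<open>w\<close> of \<open>j \<cdot> s\<close> is itself a question, namely the pair of
  \<open>s\<close> and \<open>w\<close>, whose answer is a proof of \<open>s\<close>; conversely
  each question \<open>d\<close> is discharged by its own density.\<close>

definition Pred_section_term where "Pred_section_term =
  (\<Lambda> j \<in> sProp \<rightarrow> sProp. \<Lambda> m \<in> modality j.
    sAx (FunExt 0 0) \<cdot> sProp \<cdot> (\<Lambda> _ \<in> sProp. sProp) \<cdot> j \<cdot> oracle_mod (Pred j) \<cdot>
     (\<Lambda> s \<in> sProp. propext (j \<cdot> s) (oracle_mod (Pred j) \<cdot> s)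
       (\<Lambda> w \<in> j \<cdot> s. oracle_ask (DProp j) (DProp_fst j) s (DProp_pair j s w)
           (\<Lambda> x \<in> s. oracle_prf (DProp j) (DProp_fst j) s x))
       (\<Lambda> x \<in> oracle_mod (Pred j) \<cdot> s.
          oracle_rec (DProp j) (DProp_fst j) s (j \<cdot> s) (\<lambda>y. modality_unit j m \<cdot> s \<cdot> y)
            (\<lambda>d g. DProp_bind j m (first 0 sProp (\<lambda>s. j \<cdot> s) d) s g d \<cdot>
              (\<Lambda> x \<in> first 0 sProp (\<lambda>s. j \<cdot> s) d. x)) x)))"

section \<open>Evaluation\<close>

lemmas scheme_defs =
  close_def bound_def sProp_def sType_def sPi_def sLam_def sApp_def sInd_def sElim_def
  Eq_def Conj_def Iff_def Ex_def Ex1_def Inhabited_def Sigma_type_def first_def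
  modal_le_def modality_def container_mor.simps container_le_def DProp_def DProp_fst_def
  Pred_def oracle_mod.simps
  sConstr_def sAx_def conj_pair_def conj_fst_def conj_snd_def iff_pair_def cast_def propext_def
  monotone_def inflationary_def idempotent_def modality_mono_def modality_unit_def
  modality_idem_def modality_bind_def Oracle_def oracle_prf_def oracle_ask_def oracle_rec_def
  DProp_pair_def DProp_bind_def mor_elim_def mor_intro_def adjunction_term_def oracle_mono_def
  oracle_unit_def oracle_idem_def oracle_modality_term_def oracle_functor_term_def
  Pred_functor_term_def Pred_section_term_def

lemmas checker_eqs =
  spine.simps nf_app.simps nf_elim_def nf_step.simps nf.simps srt_le.simps cumul_nf.simps
  is_subtype_def sort_of_def is_type_def dest_Pi_def check.simps check_arg.simps
  check_branches.simps family_args_def infer_step.simps infer.simps check_closed_def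
  lift.simps subst.simps occurs.simps arity_sort.simps family_app.simps
  strictly_positive.simps constr_form.simps num_args.simps motive_type.simps
  replace_head.simps ind_hyp.simps branch.simps branch_type_def rec_call.simps iota.simps
  axiom_type.simps pi_sort.simps Let_def

text \<open>Numerals are unfolded to successors so that the equations by recursion on the bound
  apply. The universe level \<open>i\<close> stays a variable; facts such as \<open>le_refl\<close>,
  \<open>le0\<close> and \<open>max.idem\<close> settle its comparisons and maxima.\<close>

lemmas data_eqs =
  tm.inject tm.distinct srt.inject srt.distinct ax.inject ax.distinct list.inject list.distinct
  nat.inject nat.distinct option.inject option.distinct prod.inject
  tm.case srt.case option.case prod.case list.case simp_thms if_True if_False
  not_less0 zero_less_Suc Suc_less_eq diff_Suc_Suc diff_0_eq_0 minus_nat.diff_0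
  add_Suc_right add_0_right add_Suc add_0 le_refl le0 Suc_le_mono max_0L max_0R max.idem
  One_nat_def numeral_eq_Suc pred_numeral_simps BitM.simps
  list.map list.size list.pred_inject list.set bex_simps nth_Cons_0 nth_Cons_Suc
  append.simps foldl.simps funpow.simps comp_apply id_apply fst_conv snd_conv

text \<open>
  Weak congruence rules prevent the simplifier from evaluating branches that are not taken. For the
  same reason the checker uses conditionals instead of disjunctions.
\<close>
lemmas lazy_congs =
  if_weak_cong option.case_cong_weak prod.case_cong_weak tm.case_cong_weak srt.case_cong_weak

section \<open>Running the checker on the five proof terms\<close>

text \<open>The number 40 is a recursion depth at which the evaluation succeeds; soundness holds for
  every bound, so its choice carries no logical weight.\<close>

lemma provable_adjunction:
  "provable
     (\<Pi> A \<in> sType i. \<Pi> P \<in> A \<rightarrow> sProp. \<Pi> j \<in> sProp \<rightarrow> sProp. modality j \<rightarrow>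
       Iff (container_le i (A, P) (Pred j)) (modal_le (oracle_mod (A, P)) j))"
  by (rule check_closed_provable[where n = 40 and t = "adjunction_term i"])
    (simp only: data_eqs scheme_defs checker_eqs cong: lazy_congs)

lemma provable_oracle_modality:
  "provable
     (\<Pi> A \<in> sType i. \<Pi> P \<in> A \<rightarrow> sProp. modality (oracle_mod (A, P)))"
  by (rule check_closed_provable[where n = 40 and t = "oracle_modality_term i"])
    (simp only: data_eqs scheme_defs checker_eqs cong: lazy_congs)

lemma provable_oracle_functor:
  "provable
     (\<Pi> A \<in> sType i. \<Pi> P \<in> A \<rightarrow> sProp. \<Pi> B \<in> sType i. \<Pi> Q \<in> B \<rightarrow> sProp.
       container_le i (A, P) (B, Q) \<rightarrow> modal_le (oracle_mod (A, P)) (oracle_mod (B, Q)))"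
  by (rule check_closed_provable[where n = 40 and t = "oracle_functor_term i"])
    (simp only: data_eqs scheme_defs checker_eqs cong: lazy_congs)

lemma provable_Pred_functor:
  "provable
     (\<Pi> j \<in> sProp \<rightarrow> sProp. \<Pi> k \<in> sProp \<rightarrow> sProp. modality j \<rightarrow> modality k \<rightarrow>
       modal_le j k \<rightarrow> container_le i (Pred j) (Pred k))"
  by (rule check_closed_provable[where n = 40 and t = "Pred_functor_term i"])
    (simp only: data_eqs scheme_defs checker_eqs cong: lazy_congs)

lemma provable_Pred_section:
  "provable
     (\<Pi> j \<in> sProp \<rightarrow> sProp. modality j \<rightarrow> Eq (sProp \<rightarrow> sProp) j (oracle_mod (Pred j)))"
  by (rule check_closed_provable[where n = 40 and t = "Pred_section_term"])
    (simp only: data_eqs scheme_defs checker_eqs cong: lazy_congs)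

theorem theorem15:
  fixes i :: nat
  shows
    "provable
       (\<Pi> A \<in> sType i. \<Pi> P \<in> A \<rightarrow> sProp. \<Pi> j \<in> sProp \<rightarrow> sProp. modality j \<rightarrow>
          Iff (container_le i (A, P) (Pred j)) (modal_le (oracle_mod (A, P)) j)) \<and>
     provable
       (\<Pi> A \<in> sType i. \<Pi> P \<in> A \<rightarrow> sProp. modality (oracle_mod (A, P))) \<and>
     provable
       (\<Pi> A \<in> sType i. \<Pi> P \<in> A \<rightarrow> sProp. \<Pi> B \<in> sType i. \<Pi> Q \<in> B \<rightarrow> sProp.
          container_le i (A, P) (B, Q) \<rightarrow> modal_le (oracle_mod (A, P)) (oracle_mod (B, Q))) \<and>
     provable
       (\<Pi> j \<in> sProp \<rightarrow> sProp. \<Pi> k \<in> sProp \<rightarrow> sProp. modality j \<rightarrow> modality k \<rightarrow>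
          modal_le j k \<rightarrow> container_le i (Pred j) (Pred k)) \<and>
     provable
       (\<Pi> j \<in> sProp \<rightarrow> sProp. modality j \<rightarrow> Eq (sProp \<rightarrow> sProp) j (oracle_mod (Pred j)))"
  using provable_adjunction provable_oracle_modality provable_oracle_functor
    provable_Pred_functor provable_Pred_section
  by (intro conjI)

end
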